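(* Let $\phi:\mathbb{R}^n\to\overline{\mathbb{R}}$ be a proper lower semicontinuous function bounded from below, let $a,b>0$, and let $\{x^k\}_{k\ge 0}\subset\mathbb{R}^n$ be a sequence such that for each $k\in\mathbb{N}$ one has $\phi(x^{k+1})+a\|x^{k+1}-x^k\|^2\le\phi(x^k)$, and there exists $w^{k}\in\partial\phi(x^{k})$ with $\|w^{k}\|\le b\|x^{k+1}-x^k\|$. Let $\bar x\in\mathrm{dom}\,\phi$ be an accumulation point of $\{x^k\}$ such that, for some subsequence, $x^{k_j}\to\bar x$ and $\phi(x^{k_j})\to\phi(\bar x)$ as $j\to\infty$. Suppose that $\phi$ satisfies the exponent PLK condition at $\bar x$ with some exponent in $[0,1)$, and that $x^{k+1}\neq x^k$ for all $k\in\mathbb{N}$. Then for every $q\in(0,\frac12)$ the exponent PLK condition of $\phi$ at $\bar x$ with exponent $q$ fails, i.e., it holds for no constant $M>0$.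
   Context: $\overline{\mathbb{R}}:=\mathbb{R}\cup\{\infty\}$, $\mathrm{dom}\,\phi:=\{x\mid\phi(x)<\infty\}$, $\mathbb{N}:=\{1,2,\ldots\}$, $\mathrm{dist}(0,\emptyset):=\infty$. For $x\in\mathrm{dom}\,\phi$, the regular subdifferential $\widehat\partial\phi(x)$ is the set of $v\in\mathbb{R}^n$ with $\liminf_{u\to x,\,u\ne x}\frac{\phi(u)-\phi(x)-\langle v,u-x\rangle}{\|u-x\|}\ge 0$, and the limiting (Mordukhovich) subdifferential is $$\partial\phi(x):=\{v\in\mathbb{R}^n\mid \exists\, x_k\to x,\ \phi(x_k)\to\phi(x),\ v_k\in\widehat\partial\phi(x_k),\ v_k\to v\};$$ both sets are empty if $x\notin\mathrm{dom}\,\phi$. Exponent PLK condition of $\phi$ at $\bar x\in\mathrm{dom}\,\phi$ with exponent $q\in[0,1)$ and constant $M>0$ (i.e., with $\varphi(t)=Mt^{1-q}$): there exist $\eta\in(0,\infty)$ and a neighborhood $U$ of $\bar x$ such that $$M(1-q)\big(\phi(x)-\phi(\bar x)\big)^{-q}\,\mathrm{dist}\big(0,\partial\phi(x)\big)\ge 1\quad\text{for all }x\in U\text{ with }\phi(\bar x)<\phi(x)<\phi(\bar x)+\eta.$$ The condition with exponent $q$ is said to hold if it holds for some $M>0$. *)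

theory Defs
  imports "HOL-Analysis.Analysis"
begin

text \<open>
  Functions with values in the reals extended by infinity are modelled as functions into \<open>ereal\<close>;
  properness excludes the value \<open>-\<infinity>\<close>.
\<close>

definition effective_domain :: "(real^'n \<Rightarrow> ereal) \<Rightarrow> (real^'n) set" where
  "effective_domain \<phi> = {x. \<phi> x < \<infinity>}"

definition proper_fun :: "(real^'n \<Rightarrow> ereal) \<Rightarrow> bool" where
  "proper_fun \<phi> \<longleftrightarrow> (\<forall>x. \<phi> x \<noteq> -\<infinity>) \<and> effective_domain \<phi> \<noteq> {}"

definition lower_semicontinuous :: "(real^'n \<Rightarrow> ereal) \<Rightarrow> bool" where
  "lower_semicontinuous \<phi> \<longleftrightarrow> (\<forall>x. \<phi> x \<le> Liminf (at x) \<phi>)"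

definition regular_subdifferential :: "(real^'n \<Rightarrow> ereal) \<Rightarrow> real^'n \<Rightarrow> (real^'n) set" where
  "regular_subdifferential \<phi> x =
    (if x \<in> effective_domain \<phi>
     then {v. 0 \<le> Liminf (at x)
                   (\<lambda>u. (\<phi> u - \<phi> x - ereal (v \<bullet> (u - x))) / ereal (norm (u - x)))}
     else {})"

definition limiting_subdifferential :: "(real^'n \<Rightarrow> ereal) \<Rightarrow> real^'n \<Rightarrow> (real^'n) set" where
  "limiting_subdifferential \<phi> x =
    (if x \<in> effective_domain \<phi>
     then {v. \<exists>y w. y \<longlonglongrightarrow> x \<and> (\<lambda>k. \<phi> (y k)) \<longlonglongrightarrow> \<phi> x \<and>
                    (\<forall>k::nat. w k \<in> regular_subdifferential \<phi> (y k)) \<and> w \<longlonglongrightarrow> v}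
     else {})"

text \<open>
  Unlike \<open>infdist\<close>, this distance is extended-valued, so that the distance to the
  empty set is \<open>\<infinity>\<close> and not \<open>0\<close>.
\<close>

definition edist_set :: "real^'n \<Rightarrow> (real^'n) set \<Rightarrow> ereal" where
  "edist_set x S = (INF y\<in>S. ereal (dist x y))"

text \<open>
  In the condition below, \<open>\<phi> x - \<phi> xbar\<close> lies strictly between \<open>0\<close> and \<open>\<eta>\<close> when \<open>\<phi> xbar\<close> is
  finite, so the conversion to a real loses nothing, \<open>powr\<close> has a positive base, and for
  \<open>M > 0\<close> and \<open>q < 1\<close> the real factor in front of the possibly infinite distance is positive.
\<close>

definition exponent_PLK_const :: "(real^'n \<Rightarrow> ereal) \<Rightarrow> real^'n \<Rightarrow> real \<Rightarrow> real \<Rightarrow> bool" where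
  "exponent_PLK_const \<phi> xbar q M \<longleftrightarrow>
    (\<exists>\<eta>::real. \<eta> > 0 \<and> (\<exists>U. open U \<and> xbar \<in> U \<and>
      (\<forall>x\<in>U. \<phi> xbar < \<phi> x \<and> \<phi> x < \<phi> xbar + ereal \<eta> \<longrightarrow>
        ereal (M * (1 - q) * real_of_ereal (\<phi> x - \<phi> xbar) powr (- q))
          * edist_set 0 (limiting_subdifferential \<phi> x) \<ge> 1)))"

definition exponent_PLK :: "(real^'n \<Rightarrow> ereal) \<Rightarrow> real^'n \<Rightarrow> real \<Rightarrow> bool" where
  "exponent_PLK \<phi> xbar q \<longleftrightarrow> (\<exists>M>0. exponent_PLK_const \<phi> xbar q M)"

end

theory Submission
  imports Defs
begin

text \<open>
  Write \<open>D k = \<phi> (x k) - \<phi> xbar\<close> and \<open>d k = norm (x (k + 1) - x k)\<close>. The values \<open>\<phi> (x k)\<close> strictly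
  decrease and accumulate at \<open>\<phi> xbar\<close>, so \<open>D k > 0\<close> for all \<open>k \<ge> 1\<close>. Two bounds on the step length
  then compete. Sufficient decrease makes it short: \<open>a * (d k)\<^sup>2 \<le> D k - D (k + 1) \<le> D k\<close>, that is,
  \<open>d k = O(D k powr (1/2))\<close>. The PLK condition with exponent \<open>q\<close> makes it long: the subgradient
  \<open>w k\<close> has norm at least a constant times \<open>D k powr q\<close>, while \<open>norm (w k) \<le> b * d k\<close>. Hence
  \<open>D k powr q = O(D k powr (1/2))\<close> whenever \<open>x k\<close> is close to \<open>xbar\<close> and \<open>D k\<close> is small. Along the
  subsequence \<open>D\<close> tends to \<open>0\<close> through positive values, which is impossible for \<open>q < 1/2\<close>.

  The lower bound on the step rests on \<open>exponent_PLK_const_imp_powr_le_norm\<close>, and the final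
  comparison of powers is \<open>powr_gt_const_mult_sqrt\<close>.
\<close>

lemma edist_set_zero_le_norm:
  assumes "w \<in> S"
  shows "edist_set 0 S \<le> ereal (norm w)"
  using INF_lower[OF assms, of "\<lambda>y. ereal (dist 0 y)"] by (simp add: edist_set_def)

text \<open>
  The PLK condition becomes an inequality between real numbers once the distance to the
  subdifferential is bounded above by the norm of one particular subgradient.
\<close>

lemma exponent_PLK_const_imp_powr_le_norm:
  assumes plk: "exponent_PLK_const \<phi> xbar q M"
    and "M > 0" and "q < 1" and F: "\<phi> xbar = ereal F"
  obtains \<eta> U where "\<eta> > 0" and "open U" and "xbar \<in> U"
    and "\<And>x w t. \<lbrakk>x \<in> U; \<phi> x = ereal t; F < t; t < F + \<eta>; w \<in> limiting_subdifferential \<phi> x\<rbrakk>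
           \<Longrightarrow> (t - F) powr q \<le> M * (1 - q) * norm w"
proof -
  obtain \<eta> U where "\<eta> > 0" "open U" "xbar \<in> U"
    and PLK: "\<And>x. \<lbrakk>x \<in> U; \<phi> xbar < \<phi> x; \<phi> x < \<phi> xbar + ereal \<eta>\<rbrakk> \<Longrightarrow>
      1 \<le> ereal (M * (1 - q) * real_of_ereal (\<phi> x - \<phi> xbar) powr (- q))
          * edist_set 0 (limiting_subdifferential \<phi> x)"
    using plk unfolding exponent_PLK_const_def by metis
  moreover have "(t - F) powr q \<le> M * (1 - q) * norm w"
    if x: "x \<in> U" "\<phi> x = ereal t" "F < t" "t < F + \<eta>"
      and w: "w \<in> limiting_subdifferential \<phi> x" for x w t
  proof -
    let ?c = "M * (1 - q) * (t - F) powr (- q)"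
    have "1 \<le> ereal ?c * edist_set 0 (limiting_subdifferential \<phi> x)"
      using PLK[of x] x F by simp
    also have "\<dots> \<le> ereal ?c * ereal (norm w)"
      using assms by (intro ereal_mult_left_mono edist_set_zero_le_norm[OF w]) simp
    finally have "1 \<le> ?c * norm w"
      by simp
    then have "(t - F) powr q * 1 \<le> (t - F) powr q * (?c * norm w)"
      by (intro mult_left_mono) simp_all
    also have "\<dots> = M * (1 - q) * norm w"
      using x(3) by (simp add: powr_minus field_simps)
    finally show ?thesis
      by simp
  qed
  ultimately show ?thesis
    using that by blast
qed

text \<open>
  Near zero a power with exponent below \<open>1/2\<close> dominates every multiple of the square root,
  because the quotient of the square root by the power is a positive power.
\<close>

lemma powr_gt_const_mult_sqrt:
  fixes D :: "'a \<Rightarrow> real"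
  assumes lim: "(D \<longlongrightarrow> 0) F" and pos: "\<And>j. D j > 0" and "q < 1/2"
  shows "\<forall>\<^sub>F j in F. C * sqrt (D j) < D j powr q"
proof -
  have "((\<lambda>j. C * D j powr (1/2 - q)) \<longlongrightarrow> C * 0 powr (1/2 - q)) F"
    using assms by (intro tendsto_intros tendsto_powr') (auto intro: always_eventually less_imp_le)
  then have "((\<lambda>j. C * D j powr (1/2 - q)) \<longlongrightarrow> 0) F"
    by simp
  then have "\<forall>\<^sub>F j in F. C * D j powr (1/2 - q) < 1"
    by (rule order_tendstoD(2)) simp
  then show ?thesis
  proof eventually_elim
    case (elim j)
    have "C * sqrt (D j) = (C * D j powr (1/2 - q)) * D j powr q"
      using pos[of j] by (simp add: powr_half_sqrt flip: powr_add)
    also have "\<dots> < 1 * D j powr q"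
      using elim pos[of j] by (intro mult_strict_right_mono) auto
    finally show ?case
      by simp
  qed
qed

lemma decseq_subseq_limit_le:
  fixes f :: "nat \<Rightarrow> real"
  assumes dec: "decseq f" and r: "strict_mono r" and lim: "(\<lambda>j. f (r j)) \<longlonglongrightarrow> L"
  shows "L \<le> f n"
proof (rule LIMSEQ_le_const2[OF lim])
  show "\<exists>N. \<forall>j\<ge>N. f (r j) \<le> f n"
    using decseqD[OF dec] seq_suble[OF r] order_trans by blast
qed

theorem theorem5:
  fixes \<phi> :: "real^'n \<Rightarrow> ereal" and a b :: real
    and x :: "nat \<Rightarrow> real^'n" and xbar :: "real^'n"
  assumes "proper_fun \<phi>"
    and "lower_semicontinuous \<phi>"
    and "\<exists>c::real. \<forall>y. ereal c \<le> \<phi> y"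
    and "a > 0" and "b > 0"
    and "\<forall>k\<ge>1. \<phi> (x (k + 1)) + ereal (a * (norm (x (k + 1) - x k))\<^sup>2) \<le> \<phi> (x k)"
    and "\<forall>k\<ge>1. \<exists>w\<in>limiting_subdifferential \<phi> (x k). norm w \<le> b * norm (x (k + 1) - x k)"
    and "xbar \<in> effective_domain \<phi>"
    and "\<exists>r::nat \<Rightarrow> nat. strict_mono r \<and> (\<lambda>j. x (r j)) \<longlonglongrightarrow> xbar \<and>
           (\<lambda>j. \<phi> (x (r j))) \<longlonglongrightarrow> \<phi> xbar"
    and "\<exists>q0. 0 \<le> q0 \<and> q0 < 1 \<and> exponent_PLK \<phi> xbar q0"
    and "\<forall>k\<ge>1. x (k + 1) \<noteq> x k"
  shows "\<forall>q. 0 < q \<and> q < 1/2 \<longrightarrow> \<not> exponent_PLK \<phi> xbar q"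
proof (intro allI impI notI)
  fix q :: real
  assume q: "0 < q \<and> q < 1/2" and "exponent_PLK \<phi> xbar q"
  then obtain M where M: "M > 0" "exponent_PLK_const \<phi> xbar q M"
    unfolding exponent_PLK_def by blast
  obtain r where r: "strict_mono r" "(\<lambda>j. x (r j)) \<longlonglongrightarrow> xbar"
      "(\<lambda>j. \<phi> (x (r j))) \<longlonglongrightarrow> \<phi> xbar"
    using assms(9) by blast
  obtain w where w: "\<And>k. k \<ge> 1 \<Longrightarrow> w k \<in> limiting_subdifferential \<phi> (x k)"
      "\<And>k. k \<ge> 1 \<Longrightarrow> norm (w k) \<le> b * norm (x (k + 1) - x k)"
    using assms(7) by metis
  have finite_on_domain: "\<phi> y = ereal (real_of_ereal (\<phi> y))" if "y \<in> effective_domain \<phi>" for y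
    using that assms(1) by (cases "\<phi> y") (auto simp: effective_domain_def proper_fun_def)
  define F where "F = real_of_ereal (\<phi> xbar)"
  \<comment> \<open>The iterate with index \<open>0\<close> is excluded: nothing makes \<open>\<phi> (x 0)\<close> finite, and descent
      is assumed from index \<open>1\<close> on.\<close>
  define f where "f k = real_of_ereal (\<phi> (x (Suc k)))" for k
  define d where "d k = norm (x (k + 1) - x k)" for k
  have F: "\<phi> xbar = ereal F"
    unfolding F_def using assms(8) by (rule finite_on_domain)
  \<comment> \<open>A point with a limiting subgradient belongs to the domain.\<close>
  have f: "\<phi> (x (Suc k)) = ereal (f k)" for k
    unfolding f_def
    using w(1)[of "Suc k"]
    by (intro finite_on_domain) (auto simp: limiting_subdifferential_def split: if_splits)
  have descent: "f (Suc k) + a * (d (Suc k))\<^sup>2 \<le> f k" for k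
    using assms(6)[rule_format, of "Suc k"] f[of k] f[of "Suc k"] by (simp add: d_def)
  have d_pos: "d (Suc k) > 0" for k
    using assms(11)[rule_format, of "Suc k"] by (simp add: d_def)
  have f_less: "f (Suc k) < f k" for k
  proof -
    have "0 < a * (d (Suc k))\<^sup>2"
      using d_pos[of k] \<open>a > 0\<close> by simp
    then show ?thesis
      using descent[of k] by linarith
  qed
  then have dec: "decseq f"
    by (intro decseq_SucI less_imp_le)
  \<comment> \<open>Dropping the first term of \<open>r\<close> makes all its indices positive, as required by the shift in \<open>f\<close>.\<close>
  define s where "s j = r (Suc j) - 1" for j
  have s: "r (Suc j) = Suc (s j)" for j
    using seq_suble[OF r(1), of "Suc j"] by (simp add: s_def)
  have s_mono: "strict_mono s"
    unfolding strict_mono_Suc_iff using r(1) s by (metis Suc_less_eq strict_mono_Suc_iff)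
  have xs: "(\<lambda>j. x (Suc (s j))) \<longlonglongrightarrow> xbar"
    using LIMSEQ_Suc[OF r(2)] by (simp add: s)
  have fs: "(\<lambda>j. f (s j)) \<longlonglongrightarrow> F"
    using LIMSEQ_Suc[OF r(3)] by (simp add: s f F)
  have F_le: "F \<le> f k" for k
    using decseq_subseq_limit_le[OF dec s_mono fs] .
  have F_less: "F < f k" for k
    using F_le[of "Suc k"] f_less[of k] by linarith
  have step_le: "d (Suc k) \<le> sqrt (f k - F) / sqrt a" for k
  proof -
    have "(d (Suc k))\<^sup>2 \<le> (f k - F) / a"
      using descent[of k] F_le[of "Suc k"] \<open>a > 0\<close> by (simp add: field_simps)
    then show ?thesis
      using real_le_rsqrt real_sqrt_divide by metis
  qed
  obtain \<eta> U where U: "\<eta> > 0" "open U" "xbar \<in> U"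
    and PLK: "\<And>y v t. \<lbrakk>y \<in> U; \<phi> y = ereal t; F < t; t < F + \<eta>; v \<in> limiting_subdifferential \<phi> y\<rbrakk>
           \<Longrightarrow> (t - F) powr q \<le> M * (1 - q) * norm v"
    using exponent_PLK_const_imp_powr_le_norm[OF M(2,1) _ F] q by auto
  define C where "C = M * (1 - q) * b / sqrt a"
  have "\<forall>\<^sub>F j in sequentially. C * sqrt (f (s j) - F) < (f (s j) - F) powr q"
    using q F_less fs by (intro powr_gt_const_mult_sqrt) (auto simp: LIM_zero)
  moreover have "\<forall>\<^sub>F j in sequentially. x (Suc (s j)) \<in> U"
    using topological_tendstoD[OF xs] U by blast
  moreover have "\<forall>\<^sub>F j in sequentially. f (s j) < F + \<eta>"
    using order_tendstoD(2)[OF fs] U by simp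
  ultimately have "\<forall>\<^sub>F j in sequentially. False"
  proof eventually_elim
    case (elim j)
    let ?k = "s j"
    have "(f ?k - F) powr q \<le> M * (1 - q) * norm (w (Suc ?k))"
      using elim by (intro PLK[OF _ f F_less _ w(1)]) auto
    also have "\<dots> \<le> M * (1 - q) * (b * d (Suc ?k))"
      using w(2)[of "Suc ?k"] M q by (intro mult_left_mono) (auto simp: d_def)
    also have "\<dots> \<le> M * (1 - q) * (b * (sqrt (f ?k - F) / sqrt a))"
      using step_le[of ?k] M q \<open>b > 0\<close> by (intro mult_left_mono) auto
    also have "\<dots> = C * sqrt (f ?k - F)"
      by (simp add: C_def)
    finally show False
      using elim by linarith
  qed
  then show False
    by simp
qed

end
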